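(* Let $\pi\in\mathcal P(\mathcal X)$, let $P_1,\dots,P_n\in\mathcal L(\mathcal X)$ be $\pi$-stationary, and let $(S_1,\dots,S_m)$ be a partition of $[d]$. Let $(\mathbf w^{(i)})_{i=1}^t$ be the output of the projected subgradient algorithm (described in the context) run for $t$ iterations with stepsize $\eta>0$ from an initial $\mathbf w^{(0)}\in\mathcal S_n$. Let $\overline{\mathbf w}^t=\frac1t\sum_{i=1}^t\mathbf w^{(i)}$ and let $\mathbf w^*$ be an optimal solution of $\min_{\mathbf w\in\mathcal S_n}h(\mathbf w)$. Then $$h(\overline{\mathbf w}^t)-h(\mathbf w^* )\le\frac n{2\eta t}+\frac{\eta B}2.$$ Furthermore, if the constant stepsize $\eta=\sqrt{\frac n{Bt}}$ is chosen, then $$h(\overline{\mathbf w}^t)-h(\mathbf w^* )\le\sqrt{\frac{nB}t}.$$ In addition, given any $\epsilon>0$, if one further chooses $t=\lceil nB/\epsilon^2\rceil$, then $h(\overline{\mathbf w}^t)-h(\mathbf w^* )\le\epsilon$.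
   Context: $[d]=\{1,\dots,d\}$; $\mathcal X=\mathcal X^{(1)}\times\cdots\times\mathcal X^{(d)}$ is a finite product state space; for $S\subseteq[d]$, $\mathcal X^{(S)}=\times_{i\in S}\mathcal X^{(i)}$, $-S=[d]\setminus S$. $\mathcal L(\mathcal Y)$ is the set of transition matrices on $\mathcal Y$. $\mathcal P(\mathcal X)$ is the set of probability mass functions on $\mathcal X$ with full support. $P$ is $\pi$-stationary if $\pi P=\pi$. $\mathcal S_n=\{\mathbf w\in\mathbb R_+^n:\sum_iw_i=1\}$, $\overline P(\mathbf w)=\sum_{i=1}^nw_iP_i$. For $\pi$-stationary $P\in\mathcal L(\mathcal X)$, the keep-$S$-in matrix is $P^{(S)}\in\mathcal L(\mathcal X^{(S)})$, $$P^{(S)}(x^{(S)},y^{(S)})=\frac{\sum_{x^{(-S)},y^{(-S)}}\pi(x)P(x,y)}{\sum_{x^{(-S)}}\pi(x)},\qquad P^{(\emptyset)}=1.$$ $(\otimes_{j=1}^mM_j)(x,y)=\prod_jM_j(x^{(S_j)},y^{(S_j)})$. $D_{\mathrm{KL}}^{\pi}(M\|L)=\sum_x\pi(x)\sum_yM(x,y)\ln\frac{M(x,y)}{L(x,y)}$, with $0\ln\frac0a:=0$ for $a\in[0,1]$. Objective: $h(\mathbf w)=-\sum_{i=1}^nw_iD_{\mathrm{KL}}^\pi(P_i\|\otimes_{k=1}^m\overline P(\mathbf w)^{(S_k)})$ on $\mathcal S_n$. Subgradient: $\mathbf g(\mathbf v)=(g_1,\dots,g_n)$ with $g_i(\mathbf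 v)=D_{\mathrm{KL}}^\pi(P_n\|\otimes_{k=1}^m\overline P(\mathbf v)^{(S_k)})-D_{\mathrm{KL}}^\pi(P_i\|\otimes_{k=1}^m\overline P(\mathbf v)^{(S_k)})$. Constant: $$B=n\left(|\mathcal X|\sup_{\mathbf v\in\mathcal S_n;\ i\in\{1,\dots,n\};\ x,y\in\mathcal X:\,P_i(x,y)>0}P_i(x,y)\ln\frac{P_i(x,y)}{(\otimes_{k=1}^m\overline P(\mathbf v)^{(S_k)})(x,y)}\right)^2.$$ Projected subgradient algorithm: given $\mathbf w^{(0)}\in\mathcal S_n$, stepsize $\eta>0$ and number of iterations $t$, for $i=1,\dots,t$ set $\mathbf v^{(i)}=\mathbf w^{(i-1)}-\eta\,\mathbf g(\mathbf w^{(i-1)})$ and $\mathbf w^{(i)}=\operatorname{arg\,min}_{\mathbf w\in\mathcal S_n}\|\mathbf w-\mathbf v^{(i)}\|_2^2$; output $(\mathbf w^{(i)})_{i=1}^t$. *)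

theory Defs
  imports "HOL-Probability.Probability"
begin

text \<open>
  A state of \<open>X\<^sup>(\<^sup>1\<^sup>) \<times> \<dots> \<times> X\<^sup>(\<^sup>d\<^sup>)\<close> is a function in \<open>Pi\<^sub>E {1..d} X\<close>, and the projection
  \<open>x\<^sup>(\<^sup>S\<^sup>)\<close> is \<open>restrict x S\<close>. Matrices are real-valued functions of two states and vectors in
  \<open>\<real>\<^sup>n\<close> are functions \<open>nat \<Rightarrow> real\<close>; only their values on the states, respectively on \<open>{1..n}\<close>,
  are ever used.
\<close>

type_synonym 'a state = "nat \<Rightarrow> 'a"
type_synonym 'a mtx = "'a state \<Rightarrow> 'a state \<Rightarrow> real"

abbreviation states :: "(nat \<Rightarrow> 'a set) \<Rightarrow> nat set \<Rightarrow> 'a state set" where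
  "states X S \<equiv> Pi\<^sub>E S X"

definition transition_matrix :: "'a state set \<Rightarrow> 'a mtx \<Rightarrow> bool" where
  "transition_matrix Y M \<longleftrightarrow>
     (\<forall>x\<in>Y. (\<forall>y\<in>Y. 0 \<le> M x y) \<and> (\<Sum>y\<in>Y. M x y) = 1)"

definition stationary :: "'a state set \<Rightarrow> 'a state pmf \<Rightarrow> 'a mtx \<Rightarrow> bool" where
  "stationary Y \<pi> M \<longleftrightarrow> (\<forall>y\<in>Y. (\<Sum>x\<in>Y. pmf \<pi> x * M x y) = pmf \<pi> y)"

definition prob_simplex :: "nat \<Rightarrow> (nat \<Rightarrow> real) set" where
  "prob_simplex n = {w. (\<forall>i\<in>{1..n}. 0 \<le> w i) \<and> (\<Sum>i=1..n. w i) = 1}"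

definition mixture :: "nat \<Rightarrow> (nat \<Rightarrow> 'a mtx) \<Rightarrow> (nat \<Rightarrow> real) \<Rightarrow> 'a mtx" where
  "mixture n P w x y = (\<Sum>i=1..n. w i * P i x y)"

text \<open>
  The sums over \<open>x\<^sup>(\<^sup>-\<^sup>S\<^sup>)\<close> and \<open>y\<^sup>(\<^sup>-\<^sup>S\<^sup>)\<close> run over the states that restrict to the given arguments
  \<open>u\<close> and \<open>v\<close> on \<open>S\<close>. For \<open>S = {}\<close> the quotient is \<open>1\<close> when \<open>M\<close> is a transition matrix and
  \<open>\<pi>\<close> has support \<open>states X {1..d}\<close>.
\<close>

definition keep_in ::
    "nat \<Rightarrow> (nat \<Rightarrow> 'a set) \<Rightarrow> 'a state pmf \<Rightarrow> nat set \<Rightarrow> 'a mtx \<Rightarrow> 'a mtx" where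
  "keep_in d X \<pi> S M u v =
     (\<Sum>x\<in>{x\<in>states X {1..d}. restrict x S = u}. \<Sum>y\<in>{y\<in>states X {1..d}. restrict y S = v}.
        pmf \<pi> x * M x y)
     / (\<Sum>x\<in>{x\<in>states X {1..d}. restrict x S = u}. pmf \<pi> x)"

definition tensor :: "nat \<Rightarrow> (nat \<Rightarrow> nat set) \<Rightarrow> (nat \<Rightarrow> 'a mtx) \<Rightarrow> 'a mtx" where
  "tensor m S M x y = (\<Prod>k=1..m. M k (restrict x (S k)) (restrict y (S k)))"

definition mixture_tensor ::
    "nat \<Rightarrow> (nat \<Rightarrow> 'a set) \<Rightarrow> 'a state pmf \<Rightarrow> nat \<Rightarrow> (nat \<Rightarrow> 'a mtx) \<Rightarrow> nat \<Rightarrow> (nat \<Rightarrow> nat set)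
      \<Rightarrow> (nat \<Rightarrow> real) \<Rightarrow> 'a mtx" where
  "mixture_tensor d X \<pi> n P m S w =
     tensor m S (\<lambda>k. keep_in d X \<pi> (S k) (mixture n P w))"

text \<open>
  \<open>p ln (p / q)\<close> with \<open>0 ln (0 / q) = 0\<close> and \<open>p ln (p / 0) = \<infinity>\<close> for \<open>p > 0\<close>. Extended reals are
  needed: on the boundary of the simplex the divergences below, and hence the constant
  \<open>step_const\<close>, may be infinite, whereas \<open>ln (p / 0) = 0\<close> in HOL.
\<close>

definition xlogx_div :: "real \<Rightarrow> real \<Rightarrow> ereal" where
  "xlogx_div p q = (if p = 0 then 0 else if q = 0 then \<infinity> else ereal (p * ln (p / q)))"

definition KL_div :: "'a state set \<Rightarrow> 'a state pmf \<Rightarrow> 'a mtx \<Rightarrow> 'a mtx \<Rightarrow> ereal" where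
  "KL_div Y \<pi> M L = (\<Sum>x\<in>Y. ereal (pmf \<pi> x) * (\<Sum>y\<in>Y. xlogx_div (M x y) (L x y)))"

text \<open>In the objective, \<open>0 * \<infinity> = 0\<close> for weights that vanish.\<close>

definition objective ::
    "nat \<Rightarrow> (nat \<Rightarrow> 'a set) \<Rightarrow> 'a state pmf \<Rightarrow> nat \<Rightarrow> (nat \<Rightarrow> 'a mtx) \<Rightarrow> nat \<Rightarrow> (nat \<Rightarrow> nat set)
      \<Rightarrow> (nat \<Rightarrow> real) \<Rightarrow> ereal" where
  "objective d X \<pi> n P m S w =
     - (\<Sum>i=1..n. ereal (w i) *
          KL_div (states X {1..d}) \<pi> (P i) (mixture_tensor d X \<pi> n P m S w))"

definition subgrad ::
    "nat \<Rightarrow> (nat \<Rightarrow> 'a set) \<Rightarrow> 'a state pmf \<Rightarrow> nat \<Rightarrow> (nat \<Rightarrow> 'a mtx) \<Rightarrow> nat \<Rightarrow> (nat \<Rightarrow> nat set)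
      \<Rightarrow> (nat \<Rightarrow> real) \<Rightarrow> nat \<Rightarrow> ereal" where
  "subgrad d X \<pi> n P m S v i =
     KL_div (states X {1..d}) \<pi> (P n) (mixture_tensor d X \<pi> n P m S v)
     - KL_div (states X {1..d}) \<pi> (P i) (mixture_tensor d X \<pi> n P m S v)"

definition step_const ::
    "nat \<Rightarrow> (nat \<Rightarrow> 'a set) \<Rightarrow> 'a state pmf \<Rightarrow> nat \<Rightarrow> (nat \<Rightarrow> 'a mtx) \<Rightarrow> nat \<Rightarrow> (nat \<Rightarrow> nat set)
      \<Rightarrow> ereal" where
  "step_const d X \<pi> n P m S =
     ereal (real n) * (ereal (real (card (states X {1..d}))) *
       (SUP (v, i, x, y) \<in> {(v, i, x, y). v \<in> prob_simplex n \<and> i \<in> {1..n} \<and>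
             x \<in> states X {1..d} \<and> y \<in> states X {1..d} \<and> P i x y > 0}.
          xlogx_div (P i x y) (mixture_tensor d X \<pi> n P m S v x y)))\<^sup>2"

text \<open>
  \<open>w 0, \<dots>, w t\<close> are the successive iterates. The equation for \<open>v\<close> is between extended reals, so it
  says in particular that the subgradient at the previous iterate is finite; otherwise the step is
  not defined.
\<close>

definition proj_subgrad_run ::
    "nat \<Rightarrow> (nat \<Rightarrow> 'a set) \<Rightarrow> 'a state pmf \<Rightarrow> nat \<Rightarrow> (nat \<Rightarrow> 'a mtx) \<Rightarrow> nat \<Rightarrow> (nat \<Rightarrow> nat set)
      \<Rightarrow> real \<Rightarrow> nat \<Rightarrow> (nat \<Rightarrow> nat \<Rightarrow> real) \<Rightarrow> bool" where
  "proj_subgrad_run d X \<pi> n P m S \<eta> t w \<longleftrightarrow>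
     w 0 \<in> prob_simplex n \<and>
     (\<forall>i\<in>{1..t}. \<exists>v :: nat \<Rightarrow> real.
        (\<forall>j\<in>{1..n}. ereal (v j) =
            ereal (w (i - 1) j) - ereal \<eta> * subgrad d X \<pi> n P m S (w (i - 1)) j) \<and>
        is_arg_min (\<lambda>u. (L2_set (\<lambda>j. u j - v j) {1..n})\<^sup>2) (\<lambda>u. u \<in> prob_simplex n) (w i))"

end

theory Submission
  imports Defs
begin

text \<open>
  Write \<open>T v\<close> for the tensor product of the marginals of the mixture with weights \<open>v\<close>, and \<open>D v i\<close> for
  the divergence of \<open>P i\<close> from \<open>T v\<close>, so that the objective is \<open>h u = - \<Sum>i. u i * D u i\<close>. The whole
  analysis rests on one variational fact, \<open>mixture_tensor_gibbs\<close>: among all \<open>v\<close> in the simplex,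
  \<open>\<Sum>i. u i * D v i\<close> is smallest at \<open>v = u\<close>. Indeed \<open>ln (T v)\<close> is the sum of the logarithms of the marginals,
  so the excess over the minimum is the sum over the blocks of the divergences between the
  marginals of the mixtures with weights \<open>u\<close> and \<open>v\<close>, and each of them is nonnegative. In other
  words, \<open>h\<close> is a supremum of linear functions of the weights, the one with slope \<open>- D v\<close> being attained
  at \<open>v\<close>. Hence \<open>h\<close> is convex and \<open>- D v\<close> is a subgradient at \<open>v\<close>; on the simplex it may be shifted by
  the constant \<open>D v n\<close> (\<open>gibbs_subgradient\<close>).

  The convergence rate is then that of every projected subgradient method: the squared distance
  to the optimum drops at each step in proportion to the suboptimality, up to an error governed by the
  norm of the subgradient (\<open>projected_subgradient_regret\<close>), and convexity transfers the average
  suboptimality to the average iterate (\<open>projected_subgradient_gap\<close>). The initial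
  squared distance is at most \<open>n\<close>. For the norm, let \<open>c\<close> be the supremum in \<open>step_const\<close>. The divergences
  \<open>D v i\<close> lie between \<open>0\<close> and \<open>card \<Omega> * c\<close> (\<open>real_KL_bounds\<close>), hence so do the absolute values of their differences,
  and the squared norm of the subgradient is at most \<open>n * (card \<Omega> * c)\<^sup>2\<close>, which is \<open>step_const\<close>. The lower
  bound \<open>0\<close> requires the rows of \<open>T v\<close> to sum to \<open>1\<close>, and this is where the blocks have to
  form a partition (\<open>sum_prod_restrict_partition\<close>).

  Infinite divergences cause no trouble. If \<open>c\<close> is infinite, so is \<open>step_const\<close>, and the claims are
  trivial. Otherwise \<open>T v\<close> is positive wherever some \<open>P i\<close> is, for all \<open>v\<close> in the simplex, and all
  quantities are real.
\<close>

section \<open>Projected subgradient steps\<close>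

lemma convex_comb_in_prob_simplex:
  assumes "w \<in> prob_simplex n" "u \<in> prob_simplex n" "0 \<le> s" "s \<le> 1"
  shows "(\<lambda>j. w j + s * (u j - w j)) \<in> prob_simplex n"
proof -
  have "0 \<le> w j + s * (u j - w j)" if "j \<in> {1..n}" for j
  proof -
    have "0 \<le> (1 - s) * w j + s * u j"
      using assms that by (auto simp: prob_simplex_def)
    then show ?thesis by (simp add: algebra_simps)
  qed
  moreover have "(\<Sum>j=1..n. w j + s * (u j - w j)) = 1"
    using assms by (simp add: prob_simplex_def sum.distrib sum_subtractf flip: sum_distrib_left)
  ultimately show ?thesis by (simp add: prob_simplex_def)
qed

lemma sqdist_prob_simplex_le:
  assumes "w \<in> prob_simplex n" "u \<in> prob_simplex n"
  shows "(\<Sum>j=1..n. (w j - u j)\<^sup>2) \<le> real n"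
proof -
  have bnd: "0 \<le> v j \<and> v j \<le> 1" if "v \<in> prob_simplex n" "j \<in> {1..n}" for v j
    using that member_le_sum[of j "{1..n}" v] by (auto simp: prob_simplex_def)
  have "(w j - u j)\<^sup>2 \<le> 1" if "j \<in> {1..n}" for j
    using bnd[OF assms(1) that] bnd[OF assms(2) that] by (auto simp: abs_square_le_1)
  then have "(\<Sum>j=1..n. (w j - u j)\<^sup>2) \<le> (\<Sum>j=1..n. 1)" by (intro sum_mono) auto
  then show ?thesis by simp
qed

text \<open>
  The nearest point \<open>w\<close> of the simplex to \<open>v\<close> sees every other point \<open>u\<close> of the simplex at an
  obtuse angle from \<open>v\<close>: moving from \<open>w\<close> towards \<open>u\<close> by a fraction \<open>s\<close> changes the squared distance
  by \<open>- 2 s c + s\<^sup>2 e\<close>, where \<open>c\<close> is the inner product of \<open>v - w\<close> and \<open>u - w\<close>, and this would be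
  negative for small \<open>s\<close> if \<open>c\<close> were positive. By the law of cosines the projection then brings \<open>v\<close>
  closer to \<open>u\<close>.
\<close>

lemma projection_contracts:
  assumes argmin: "is_arg_min (\<lambda>u. (L2_set (\<lambda>j. u j - v j) {1..n})\<^sup>2) (\<lambda>u. u \<in> prob_simplex n) w"
    and u: "u \<in> prob_simplex n"
  shows "(\<Sum>j=1..n. (w j - u j)\<^sup>2) \<le> (\<Sum>j=1..n. (v j - u j)\<^sup>2)"
proof -
  have L2: "(L2_set f {1..n})\<^sup>2 = (\<Sum>j=1..n. (f j)\<^sup>2)" for f
    by (simp add: L2_set_def sum_nonneg)
  have w: "w \<in> prob_simplex n"
    and min: "\<And>z. z \<in> prob_simplex n \<Longrightarrow>
      (\<Sum>j=1..n. (w j - v j)\<^sup>2) \<le> (\<Sum>j=1..n. (z j - v j)\<^sup>2)"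
    using argmin unfolding is_arg_min_linorder L2 by blast+
  define c where "c = (\<Sum>j=1..n. (v j - w j) * (u j - w j))"
  define e where "e = (\<Sum>j=1..n. (u j - w j)\<^sup>2)"
  have e: "e \<ge> 0" by (simp add: e_def sum_nonneg)
  have key: "2 * c \<le> s * e" if s: "0 < s" "s \<le> 1" for s
  proof -
    have "(\<Sum>j=1..n. (w j - v j)\<^sup>2) \<le> (\<Sum>j=1..n. (w j + s * (u j - w j) - v j)\<^sup>2)"
      using convex_comb_in_prob_simplex[OF w u] s by (intro min) auto
    also have "\<dots> = (\<Sum>j=1..n. (w j - v j)\<^sup>2 - 2 * s * ((v j - w j) * (u j - w j)) + s\<^sup>2 * (u j - w j)\<^sup>2)"
      by (intro sum.cong refl) (simp add: power2_eq_square algebra_simps)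
    also have "\<dots> = (\<Sum>j=1..n. (w j - v j)\<^sup>2) - 2 * s * c + s\<^sup>2 * e"
      by (simp add: sum.distrib sum_subtractf sum_distrib_left c_def e_def)
    finally have "s * (2 * c) \<le> s * (s * e)" by (simp add: power2_eq_square algebra_simps)
    then show ?thesis using s by simp
  qed
  have "c \<le> 0"
  proof (rule ccontr)
    assume "\<not> c \<le> 0"
    then have c: "c > 0" by simp
    define s where "s = min 1 (c / (e + 1))"
    have "0 < s" "s \<le> 1" using c e by (auto simp: s_def)
    then have "2 * c \<le> s * e" by (rule key)
    also have "\<dots> \<le> c / (e + 1) * e" using e by (intro mult_right_mono) (auto simp: s_def)
    also have "\<dots> \<le> c" using c e by (simp add: field_simps)
    finally show False using c by simp
  qed
  have "(\<Sum>j=1..n. (v j - u j)\<^sup>2)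
      = (\<Sum>j=1..n. (v j - w j)\<^sup>2 + (w j - u j)\<^sup>2 - 2 * ((v j - w j) * (u j - w j)))"
    by (intro sum.cong refl) (simp add: power2_eq_square algebra_simps)
  also have "\<dots> = (\<Sum>j=1..n. (v j - w j)\<^sup>2) + (\<Sum>j=1..n. (w j - u j)\<^sup>2) - 2 * c"
    by (simp add: sum.distrib sum_subtractf sum_distrib_left c_def)
  finally show ?thesis using \<open>c \<le> 0\<close> sum_nonneg[of "{1..n}" "\<lambda>j. (v j - w j)\<^sup>2"] by simp
qed

text \<open>
  The squared distance to \<open>u\<close> is a potential. A step from \<open>w i\<close> changes it by at most
  \<open>- 2 \<eta> \<langle>g i, w i - u\<rangle> + \<eta>\<^sup>2 B\<close>, so the inner products telescope. The last
  inner product, at \<open>w t\<close>, is controlled by a hypothetical unprojected step from \<open>w t\<close>, for which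
  it suffices that the squared distance after it is nonnegative. This is why the sum can run
  over \<open>w 1, \<dots>, w t\<close> rather than \<open>w 0, \<dots>, w (t - 1)\<close>.
\<close>

lemma projected_subgradient_regret:
  fixes w g :: "nat \<Rightarrow> nat \<Rightarrow> real"
  assumes step: "\<And>i. i \<in> {1..<t} \<Longrightarrow>
      is_arg_min (\<lambda>u. (L2_set (\<lambda>j. u j - (w i j - \<eta> * g i j)) {1..n})\<^sup>2)
        (\<lambda>u. u \<in> prob_simplex n) (w (Suc i))"
    and w1: "w 1 \<in> prob_simplex n"
    and u: "u \<in> prob_simplex n"
    and g: "\<And>i. i \<in> {1..t} \<Longrightarrow> (\<Sum>j=1..n. (g i j)\<^sup>2) \<le> B"
    and \<eta>: "\<eta> > 0" and t: "t \<ge> 1"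
  shows "(\<Sum>i=1..t. \<Sum>j=1..n. g i j * (w i j - u j)) \<le> real n / (2 * \<eta>) + real t * (\<eta> * B / 2)"
proof -
  define r where "r i = (\<Sum>j=1..n. g i j * (w i j - u j))" for i
  define dist2 where "dist2 i = (\<Sum>j=1..n. (w i j - u j)\<^sup>2)" for i
  define dist2' where "dist2' i = (\<Sum>j=1..n. (w i j - \<eta> * g i j - u j)\<^sup>2)" for i
  have expand: "dist2' i \<le> dist2 i - 2 * \<eta> * r i + \<eta>\<^sup>2 * B" if i: "i \<in> {1..t}" for i
  proof -
    have "dist2' i = (\<Sum>j=1..n. (w i j - u j)\<^sup>2 - 2 * \<eta> * (g i j * (w i j - u j)) + \<eta>\<^sup>2 * (g i j)\<^sup>2)"
      unfolding dist2'_def by (intro sum.cong refl) (simp add: power2_eq_square algebra_simps)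
    also have "\<dots> = dist2 i - 2 * \<eta> * r i + \<eta>\<^sup>2 * (\<Sum>j=1..n. (g i j)\<^sup>2)"
      by (simp add: sum.distrib sum_subtractf sum_distrib_left r_def dist2_def)
    also have "\<dots> \<le> dist2 i - 2 * \<eta> * r i + \<eta>\<^sup>2 * B"
      using g[OF i] by (intro add_left_mono mult_left_mono) auto
    finally show ?thesis .
  qed
  have tele: "2 * \<eta> * (\<Sum>i=1..s. r i) \<le> dist2 1 - dist2' s + real s * (\<eta>\<^sup>2 * B)"
    if "1 \<le> s" "s \<le> t" for s
    using that
  proof (induction s rule: nat_induct_at_least)
    case base
    then show ?case using expand[of 1] by simp
  next
    case (Suc s)
    have "dist2 (Suc s) \<le> dist2' s"
      using projection_contracts[OF step u, of s] Suc.hyps Suc.prems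
      unfolding dist2_def dist2'_def by simp
    then show ?case
      using Suc.IH Suc.prems expand[of "Suc s"] by (simp add: algebra_simps)
  qed
  have "dist2' t \<ge> 0" by (simp add: dist2'_def sum_nonneg)
  moreover have "dist2 1 \<le> real n"
    unfolding dist2_def by (rule sqdist_prob_simplex_le[OF w1 u])
  ultimately have "2 * \<eta> * (\<Sum>i=1..t. r i) \<le> real n + real t * (\<eta>\<^sup>2 * B)"
    using tele[OF t order_refl] by simp
  then have "(\<Sum>i=1..t. r i) \<le> real n / (2 * \<eta>) + real t * (\<eta> * B / 2)"
    using \<eta> by (simp add: field_simps power2_eq_square)
  then show ?thesis by (simp add: r_def)
qed

text \<open>
  Here \<open>D v i\<close> is an abstract loss of component \<open>i\<close> at the parameter \<open>v\<close>, and the function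
  to be minimised is \<open>u \<mapsto> - \<Sum>i. u i * D u i\<close>. The hypothesis \<open>gibbs\<close> says that \<open>u\<close> itself is the
  best parameter for the weights \<open>u\<close>, and it makes \<open>- D v\<close> a subgradient at \<open>v\<close>. Adding the same
  constant \<open>D v n\<close> to all its components does not change its products with differences
  \<open>u - v\<close>, which sum to zero.
\<close>

lemma gibbs_subgradient:
  fixes D :: "(nat \<Rightarrow> real) \<Rightarrow> nat \<Rightarrow> real"
  assumes u: "u \<in> prob_simplex n" and v: "v \<in> prob_simplex n"
    and gibbs: "(\<Sum>i=1..n. u i * D u i) \<le> (\<Sum>i=1..n. u i * D v i)"
  shows "(\<Sum>i=1..n. u i * D u i) - (\<Sum>i=1..n. v i * D v i)
           \<le> (\<Sum>i=1..n. (D v n - D v i) * (v i - u i))"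
proof -
  have "(\<Sum>i=1..n. (D v n - D v i) * (v i - u i))
     = (\<Sum>i=1..n. D v n * v i - D v n * u i - v i * D v i + u i * D v i)"
    by (intro sum.cong refl) (simp add: algebra_simps)
  also have "\<dots> = (\<Sum>i=1..n. u i * D v i) - (\<Sum>i=1..n. v i * D v i)"
    using u v by (simp add: sum.distrib sum_subtractf prob_simplex_def flip: sum_distrib_left)
  finally show ?thesis using gibbs by simp
qed

lemma average_in_prob_simplex:
  assumes "t \<ge> 1" and "\<And>i. i \<in> {1..t} \<Longrightarrow> w i \<in> prob_simplex n"
  shows "(\<lambda>j. (1 / real t) * (\<Sum>i=1..t. w i j)) \<in> prob_simplex n"
proof -
  have "(\<Sum>j=1..n. (1 / real t) * (\<Sum>i=1..t. w i j)) = (1 / real t) * (\<Sum>i=1..t. \<Sum>j=1..n. w i j)"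
    by (subst sum.swap) (simp only: sum_distrib_left)
  also have "(\<Sum>i=1..t. \<Sum>j=1..n. w i j) = (\<Sum>i=1..t. 1)"
    using assms(2) by (intro sum.cong refl) (simp add: prob_simplex_def)
  finally have "(\<Sum>j=1..n. (1 / real t) * (\<Sum>i=1..t. w i j)) = 1" using assms(1) by simp
  moreover have "0 \<le> (1 / real t) * (\<Sum>i=1..t. w i j)" if "j \<in> {1..n}" for j
    using assms(2) that by (intro mult_nonneg_nonneg sum_nonneg) (auto simp: prob_simplex_def)
  ultimately show ?thesis by (auto simp: prob_simplex_def)
qed

text \<open>
  Jensen's inequality for the average is the subgradient inequality at the average itself, whose
  linear terms cancel when summed over the iterates.
\<close>

lemma projected_subgradient_gap:
  fixes D :: "(nat \<Rightarrow> real) \<Rightarrow> nat \<Rightarrow> real" and w :: "nat \<Rightarrow> nat \<Rightarrow> real"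
  assumes gibbs: "\<And>u v. u \<in> prob_simplex n \<Longrightarrow> v \<in> prob_simplex n \<Longrightarrow>
      (\<Sum>i=1..n. u i * D u i) \<le> (\<Sum>i=1..n. u i * D v i)"
    and D: "\<And>v i. v \<in> prob_simplex n \<Longrightarrow> i \<in> {1..n} \<Longrightarrow> 0 \<le> D v i \<and> D v i \<le> C"
    and step: "\<And>i. i \<in> {1..<t} \<Longrightarrow>
      is_arg_min (\<lambda>u. (L2_set (\<lambda>j. u j - (w i j - \<eta> * (D (w i) n - D (w i) j))) {1..n})\<^sup>2)
        (\<lambda>u. u \<in> prob_simplex n) (w (Suc i))"
    and w: "\<And>i. i \<in> {1..t} \<Longrightarrow> w i \<in> prob_simplex n"
    and u: "u \<in> prob_simplex n"
    and \<eta>: "\<eta> > 0" and t: "t \<ge> 1"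
    and wbar: "wbar = (\<lambda>j. (1 / real t) * (\<Sum>i=1..t. w i j))"
  shows "(\<Sum>i=1..n. u i * D u i) - (\<Sum>i=1..n. wbar i * D wbar i)
           \<le> real n / (2 * \<eta> * real t) + \<eta> * (real n * C\<^sup>2) / 2"
proof -
  define K where "K v = (\<Sum>i=1..n. v i * D v i)" for v
  define g where "g v j = D v n - D v j" for v j
  have sub: "K a - K b \<le> (\<Sum>j=1..n. g b j * (b j - a j))"
    if "a \<in> prob_simplex n" "b \<in> prob_simplex n" for a b
    using gibbs_subgradient[of a n b D] gibbs that unfolding K_def g_def by blast
  have wb: "wbar \<in> prob_simplex n"
    unfolding wbar using average_in_prob_simplex[OF t w] by simp
  have "(\<Sum>i=1..t. K (w i) - K wbar) \<le> (\<Sum>i=1..t. \<Sum>j=1..n. g wbar j * (wbar j - w i j))"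
    by (intro sum_mono sub w wb)
  also have "\<dots> = (\<Sum>j=1..n. g wbar j * (real t * wbar j - (\<Sum>i=1..t. w i j)))"
    by (subst sum.swap) (simp add: sum_subtractf flip: sum_distrib_left)
  also have "\<dots> = 0" using t by (simp add: wbar)
  finally have jensen: "(\<Sum>i=1..t. K (w i)) \<le> real t * K wbar" by (simp add: sum_subtractf)
  have gB: "(\<Sum>j=1..n. (g (w i) j)\<^sup>2) \<le> real n * C\<^sup>2" if i: "i \<in> {1..t}" for i
  proof -
    have "(g (w i) j)\<^sup>2 \<le> C\<^sup>2" if j: "j \<in> {1..n}" for j
    proof -
      have "n \<in> {1..n}" using j by simp
      then have "\<bar>g (w i) j\<bar> \<le> \<bar>C\<bar>"
        using D[OF w[OF i] j] D[OF w[OF i], of n] by (auto simp: g_def)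
      then show ?thesis by (simp add: abs_le_square_iff)
    qed
    then have "(\<Sum>j=1..n. (g (w i) j)\<^sup>2) \<le> (\<Sum>j=1..n. C\<^sup>2)" by (intro sum_mono)
    then show ?thesis by simp
  qed
  have "real t * K u - (\<Sum>i=1..t. K (w i)) = (\<Sum>i=1..t. K u - K (w i))"
    by (simp add: sum_subtractf)
  also have "\<dots> \<le> (\<Sum>i=1..t. \<Sum>j=1..n. g (w i) j * (w i j - u j))"
    by (intro sum_mono sub u w)
  also have "\<dots> \<le> real n / (2 * \<eta>) + real t * (\<eta> * (real n * C\<^sup>2) / 2)"
    using step w[of 1] t
    by (intro projected_subgradient_regret gB u \<eta>) (auto simp: g_def)
  finally have "real t * (K u - K wbar) \<le> real n / (2 * \<eta>) + real t * (\<eta> * (real n * C\<^sup>2) / 2)"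
    using jensen by (simp add: algebra_simps)
  then have "K u - K wbar \<le> (real n / (2 * \<eta>) + real t * (\<eta> * (real n * C\<^sup>2) / 2)) / real t"
    using t by (simp add: pos_le_divide_eq mult.commute)
  also have "\<dots> = real n / (2 * \<eta> * real t) + \<eta> * (real n * C\<^sup>2) / 2"
    using t by (simp add: add_divide_distrib)
  finally show ?thesis by (simp add: K_def)
qed

section \<open>Marginals of transition matrices on a product space\<close>

text \<open>
  A point of a product over a disjoint union is the same as a family of points of the partial
  products, so a product of functions of the partial projections sums to a product of sums.
\<close>

lemma sum_prod_restrict_partition:
  fixes f :: "'k \<Rightarrow> ('i \<Rightarrow> 'a) \<Rightarrow> 'b::comm_semiring_1"
  assumes K: "finite K" and disj: "disjoint_family_on S K"
    and fin: "\<And>k. k \<in> K \<Longrightarrow> finite (Pi\<^sub>E (S k) X)"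
  shows "(\<Sum>y\<in>Pi\<^sub>E (\<Union>k\<in>K. S k) X. \<Prod>k\<in>K. f k (restrict y (S k)))
           = (\<Prod>k\<in>K. \<Sum>b\<in>Pi\<^sub>E (S k) X. f k b)"
proof -
  let ?h = "\<lambda>y. \<lambda>k\<in>K. restrict y (S k)"
  have "bij_betw ?h (Pi\<^sub>E (\<Union>k\<in>K. S k) X) (Pi\<^sub>E K (\<lambda>k. Pi\<^sub>E (S k) X))"
  proof (rule bij_betw_imageI)
    show "inj_on ?h (Pi\<^sub>E (\<Union>k\<in>K. S k) X)"
    proof (rule inj_onI)
      fix y z assume y: "y \<in> Pi\<^sub>E (\<Union>k\<in>K. S k) X" and z: "z \<in> Pi\<^sub>E (\<Union>k\<in>K. S k) X"
        and eq: "?h y = ?h z"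
      show "y = z"
      proof (rule PiE_ext[OF y z])
        fix i assume "i \<in> (\<Union>k\<in>K. S k)"
        then obtain k where k: "k \<in> K" "i \<in> S k" by blast
        then show "y i = z i" using fun_cong[OF fun_cong[OF eq, of k], of i] by simp
      qed
    qed
    show "?h ` Pi\<^sub>E (\<Union>k\<in>K. S k) X = Pi\<^sub>E K (\<lambda>k. Pi\<^sub>E (S k) X)"
    proof (intro equalityI subsetI)
      fix g assume "g \<in> ?h ` Pi\<^sub>E (\<Union>k\<in>K. S k) X"
      then show "g \<in> Pi\<^sub>E K (\<lambda>k. Pi\<^sub>E (S k) X)" by (fastforce simp: PiE_iff)
    next
      fix g assume g: "g \<in> Pi\<^sub>E K (\<lambda>k. Pi\<^sub>E (S k) X)"
      define y where "y = (\<lambda>i\<in>(\<Union>k\<in>K. S k). g (THE k. k \<in> K \<and> i \<in> S k) i)"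
      have y: "y i = g k i" if "k \<in> K" "i \<in> S k" for k i
      proof -
        have "(THE k. k \<in> K \<and> i \<in> S k) = k"
          using that disj by (intro the_equality) (auto simp: disjoint_family_on_def)
        then show ?thesis using that by (auto simp: y_def)
      qed
      have "y \<in> Pi\<^sub>E (\<Union>k\<in>K. S k) X"
      proof (rule PiE_I)
        fix i assume "i \<in> (\<Union>k\<in>K. S k)"
        then obtain k where k: "k \<in> K" "i \<in> S k" by blast
        then show "y i \<in> X i" using PiE_mem[OF PiE_mem[OF g k(1)] k(2)] y[OF k] by simp
      qed (simp add: y_def)
      moreover have "?h y = g"
      proof (rule extensionalityI[of _ K])
        fix k assume k: "k \<in> K"
        have "restrict y (S k) = g k"
          by (rule extensionalityI[of _ "S k"])
            (use y[OF k] PiE_mem[OF g k] in \<open>auto simp: PiE_iff\<close>)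
        then show "?h y k = g k" using k by simp
      qed (use g in \<open>auto simp: PiE_iff\<close>)
      ultimately show "g \<in> ?h ` Pi\<^sub>E (\<Union>k\<in>K. S k) X" by blast
    qed
  qed
  then have "(\<Sum>g\<in>Pi\<^sub>E K (\<lambda>k. Pi\<^sub>E (S k) X). \<Prod>k\<in>K. f k (g k))
      = (\<Sum>y\<in>Pi\<^sub>E (\<Union>k\<in>K. S k) X. \<Prod>k\<in>K. f k (?h y k))"
    by (rule sum.reindex_bij_betw[symmetric])
  then show ?thesis using K fin by (simp add: prod_sum_PiE)
qed

text \<open>
  The simplifier would turn \<open>{1..d}\<close> into \<open>{Suc 0..d}\<close>, to which facts about \<open>states X {1..d}\<close> do not
  apply.
\<close>

declare One_nat_def [simp del]

locale positive_product_pmf =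
  fixes d :: nat and X :: "nat \<Rightarrow> 'a set" and \<pi> :: "'a state pmf"
  assumes finite_factor: "\<And>i. i \<in> {1..d} \<Longrightarrow> finite (X i)"
    and support: "set_pmf \<pi> = states X {1..d}"
begin

abbreviation \<Omega> :: "'a state set" where "\<Omega> \<equiv> states X {1..d}"

lemma finite_states: "T \<subseteq> {1..d} \<Longrightarrow> finite (states X T)"
  using finite_factor by (intro finite_PiE) (auto intro: finite_subset)

lemma finite_\<Omega> [simp]: "finite \<Omega>"
  by (rule finite_states) simp

lemma \<Omega>_nonempty: "\<Omega> \<noteq> {}"
  using support set_pmf_not_empty by metis

lemma pmf_pos: "x \<in> \<Omega> \<Longrightarrow> pmf \<pi> x > 0"
  using support by (metis pmf_positive)

lemma sum_pmf: "(\<Sum>x\<in>\<Omega>. pmf \<pi> x) = 1"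
  using support by (intro sum_pmf_eq_1) auto

lemma restrict_states: "x \<in> \<Omega> \<Longrightarrow> T \<subseteq> {1..d} \<Longrightarrow> restrict x T \<in> states X T"
  by (auto simp: PiE_iff)

definition marginal :: "nat set \<Rightarrow> 'a state \<Rightarrow> real" where
  "marginal T u = (\<Sum>x\<in>{x\<in>\<Omega>. restrict x T = u}. pmf \<pi> x)"

lemma marginal_nonneg: "marginal T u \<ge> 0"
  by (simp add: marginal_def sum_nonneg)

lemma marginal_pos:
  assumes "x \<in> \<Omega>"
  shows "marginal T (restrict x T) > 0"
  unfolding marginal_def
  by (rule sum_pos2[of _ x]) (use assms pmf_pos in auto)

text \<open>
  The quotient in \<open>keep_in\<close> is harmless also at the points \<open>u\<close> of marginal mass \<open>0\<close>, because the
  numerator vanishes there.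
\<close>

lemma marginal_keep_in:
  "marginal T u * keep_in d X \<pi> T M u v
     = (\<Sum>x\<in>{x\<in>\<Omega>. restrict x T = u}. \<Sum>y\<in>{y\<in>\<Omega>. restrict y T = v}. pmf \<pi> x * M x y)"
proof (cases "marginal T u = 0")
  case True
  have "{x\<in>\<Omega>. restrict x T = u} = {}" using marginal_pos[of _ T] True by fastforce
  then show ?thesis by (simp only: True) simp
next
  case False
  then show ?thesis by (simp add: keep_in_def marginal_def)
qed

lemma keep_in_nonneg:
  assumes "\<And>x y. x \<in> \<Omega> \<Longrightarrow> y \<in> \<Omega> \<Longrightarrow> 0 \<le> M x y"
  shows "0 \<le> keep_in d X \<pi> T M u v"
  unfolding keep_in_def using assms by (intro divide_nonneg_nonneg sum_nonneg) auto

text \<open>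
  Expectations of functions of the \<open>T\<close>-coordinates of two consecutive states can be computed with the
  matrix \<open>keep_in\<close> and the marginal of \<open>\<pi>\<close>.
\<close>

lemma sum_restrict_eq_sum_keep_in:
  assumes T: "T \<subseteq> {1..d}"
  shows "(\<Sum>x\<in>\<Omega>. \<Sum>y\<in>\<Omega>. pmf \<pi> x * M x y * F (restrict x T) (restrict y T))
    = (\<Sum>a\<in>states X T. \<Sum>b\<in>states X T. marginal T a * keep_in d X \<pi> T M a b * F a b)"
proof -
  have group: "(\<Sum>x\<in>\<Omega>. G x) = (\<Sum>a\<in>states X T. \<Sum>x\<in>{x\<in>\<Omega>. restrict x T = a}. G x)"
    for G :: "'a state \<Rightarrow> real"
    by (rule sum.group[symmetric]) (use T finite_states restrict_states in auto)
  have "(\<Sum>x\<in>\<Omega>. \<Sum>y\<in>\<Omega>. pmf \<pi> x * M x y * F (restrict x T) (restrict y T))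
    = (\<Sum>a\<in>states X T. \<Sum>x\<in>{x\<in>\<Omega>. restrict x T = a}. \<Sum>b\<in>states X T.
        \<Sum>y\<in>{y\<in>\<Omega>. restrict y T = b}. pmf \<pi> x * M x y * F (restrict x T) (restrict y T))"
    by (simp only: group)
  also have "\<dots> = (\<Sum>a\<in>states X T. \<Sum>b\<in>states X T. \<Sum>x\<in>{x\<in>\<Omega>. restrict x T = a}.
        \<Sum>y\<in>{y\<in>\<Omega>. restrict y T = b}. pmf \<pi> x * M x y * F (restrict x T) (restrict y T))"
    by (intro sum.cong refl sum.swap)
  also have "\<dots> = (\<Sum>a\<in>states X T. \<Sum>b\<in>states X T. (\<Sum>x\<in>{x\<in>\<Omega>. restrict x T = a}.
        \<Sum>y\<in>{y\<in>\<Omega>. restrict y T = b}. pmf \<pi> x * M x y) * F a b)"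
    unfolding sum_distrib_right by (intro sum.cong refl) auto
  finally show ?thesis by (simp add: marginal_keep_in)
qed

lemma sum_keep_in_row:
  assumes T: "T \<subseteq> {1..d}" and M: "transition_matrix \<Omega> M" and x: "x \<in> \<Omega>"
  shows "(\<Sum>b\<in>states X T. keep_in d X \<pi> T M (restrict x T) b) = 1"
proof -
  let ?u = "restrict x T"
  have "marginal T ?u * (\<Sum>b\<in>states X T. keep_in d X \<pi> T M ?u b)
    = (\<Sum>b\<in>states X T. \<Sum>x\<in>{x\<in>\<Omega>. restrict x T = ?u}. \<Sum>y\<in>{y\<in>\<Omega>. restrict y T = b}. pmf \<pi> x * M x y)"
    by (simp add: sum_distrib_left marginal_keep_in)
  also have "\<dots> = (\<Sum>x\<in>{x\<in>\<Omega>. restrict x T = ?u}. \<Sum>b\<in>states X T. \<Sum>y\<in>{y\<in>\<Omega>. restrict y T = b}. pmf \<pi> x * M x y)"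
    by (rule sum.swap)
  also have "\<dots> = (\<Sum>x\<in>{x\<in>\<Omega>. restrict x T = ?u}. \<Sum>y\<in>\<Omega>. pmf \<pi> x * M x y)"
    by (intro sum.cong refl sum.group) (use T finite_states restrict_states in auto)
  also have "\<dots> = marginal T ?u"
    using M by (simp add: marginal_def transition_matrix_def flip: sum_distrib_left)
  finally show ?thesis using marginal_pos[OF x, of T] by simp
qed

lemma keep_in_pos:
  assumes nonneg: "\<And>x y. x \<in> \<Omega> \<Longrightarrow> y \<in> \<Omega> \<Longrightarrow> 0 \<le> M x y"
    and xy: "x \<in> \<Omega>" "y \<in> \<Omega>" and pos: "M x y > 0"
  shows "keep_in d X \<pi> T M (restrict x T) (restrict y T) > 0"
proof -
  let ?A = "\<lambda>x. {z\<in>\<Omega>. restrict z T = restrict x T}"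
  have inner: "(\<Sum>z\<in>?A y. pmf \<pi> x * M x z) > 0"
    by (rule sum_pos2[of _ y]) (use assms pmf_pos[OF xy(1)] in auto)
  have "marginal T (restrict x T) * keep_in d X \<pi> T M (restrict x T) (restrict y T) > 0"
    unfolding marginal_keep_in
    by (rule sum_pos2[of _ x]) (use nonneg xy inner in \<open>auto intro!: sum_nonneg\<close>)
  then show ?thesis using marginal_nonneg[of T "restrict x T"] by (auto simp: zero_less_mult_iff)
qed

lemma transition_matrix_tensor_keep_in:
  assumes M: "transition_matrix \<Omega> M"
    and disj: "disjoint_family_on S {1..m}" and un: "(\<Union>k\<in>{1..m}. S k) = {1..d}"
  shows "transition_matrix \<Omega> (tensor m S (\<lambda>k. keep_in d X \<pi> (S k) M))"
  unfolding transition_matrix_def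
proof (intro ballI conjI)
  fix x assume x: "x \<in> \<Omega>"
  have sub: "S k \<subseteq> {1..d}" if "k \<in> {1..m}" for k using un that by blast
  show "0 \<le> tensor m S (\<lambda>k. keep_in d X \<pi> (S k) M) x y" for y
    unfolding tensor_def using M
    by (intro prod_nonneg keep_in_nonneg) (auto simp: transition_matrix_def)
  have "(\<Sum>y\<in>\<Omega>. tensor m S (\<lambda>k. keep_in d X \<pi> (S k) M) x y)
    = (\<Prod>k=1..m. \<Sum>b\<in>states X (S k). keep_in d X \<pi> (S k) M (restrict x (S k)) b)"
    unfolding tensor_def un[symmetric]
    by (rule sum_prod_restrict_partition) (use disj finite_states sub in auto)
  also have "\<dots> = 1" using sum_keep_in_row[OF sub M x] by simp
  finally show "(\<Sum>y\<in>\<Omega>. tensor m S (\<lambda>k. keep_in d X \<pi> (S k) M) x y) = 1" .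
qed

section \<open>Divergences between transition matrices\<close>

text \<open>
  The divergence as a real number. It is meaningful when \<open>L\<close> is positive wherever \<open>M\<close> is, and then
  it agrees with \<open>KL_div\<close>.
\<close>

definition real_KL :: "'a mtx \<Rightarrow> 'a mtx \<Rightarrow> real" where
  "real_KL M L = (\<Sum>x\<in>\<Omega>. pmf \<pi> x * (\<Sum>y\<in>\<Omega>. M x y * ln (M x y / L x y)))"

lemma KL_div_eq_real_KL:
  assumes "\<And>x y. x \<in> \<Omega> \<Longrightarrow> y \<in> \<Omega> \<Longrightarrow> M x y \<noteq> 0 \<Longrightarrow> L x y \<noteq> 0"
  shows "KL_div \<Omega> \<pi> M L = ereal (real_KL M L)"
proof -
  have "xlogx_div (M x y) (L x y) = ereal (M x y * ln (M x y / L x y))" if "x \<in> \<Omega>" "y \<in> \<Omega>" for x y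
    using assms that by (auto simp: xlogx_div_def)
  then have "KL_div \<Omega> \<pi> M L
      = (\<Sum>x\<in>\<Omega>. ereal (pmf \<pi> x) * (\<Sum>y\<in>\<Omega>. ereal (M x y * ln (M x y / L x y))))"
    unfolding KL_div_def by (intro sum.cong arg_cong2[where f = "(*)"] refl) auto
  then show ?thesis by (simp add: real_KL_def)
qed

lemma ln_ratio_ge:
  fixes p q :: real
  assumes "0 \<le> p" "0 \<le> q" "p > 0 \<Longrightarrow> q > 0"
  shows "p - q \<le> p * ln (p / q)"
proof (cases "p = 0")
  case False
  then have pos: "p > 0" "q > 0" using assms by auto
  have "ln (q / p) \<le> q / p - 1" using pos by (intro ln_le_minus_one) auto
  then have "1 - q / p \<le> ln (p / q)" using pos by (simp add: ln_div)
  then have "p * (1 - q / p) \<le> p * ln (p / q)" using pos by (intro mult_left_mono) auto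
  then show ?thesis using pos by (simp add: algebra_simps)
qed (use assms in simp)

lemma KL_row_nonneg:
  assumes M: "transition_matrix \<Omega> M" and L: "transition_matrix \<Omega> L" and x: "x \<in> \<Omega>"
    and ac: "\<And>y. y \<in> \<Omega> \<Longrightarrow> M x y > 0 \<Longrightarrow> L x y > 0"
  shows "0 \<le> (\<Sum>y\<in>\<Omega>. M x y * ln (M x y / L x y))"
proof -
  have "(\<Sum>y\<in>\<Omega>. M x y - L x y) \<le> (\<Sum>y\<in>\<Omega>. M x y * ln (M x y / L x y))"
    using assms by (intro sum_mono ln_ratio_ge) (auto simp: transition_matrix_def)
  then show ?thesis using M L x by (simp add: sum_subtractf transition_matrix_def)
qed

text \<open>
  The bound \<open>r\<close> on the terms with \<open>M x y > 0\<close> cannot be negative: since \<open>M x y \<le> 1\<close>, the divergence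
  of a row would then be at most \<open>r\<close>. Hence \<open>r\<close> also bounds the vanishing terms, and the sum of a row
  is at most the number of states times \<open>r\<close>.
\<close>

lemma real_KL_bounds:
  assumes M: "transition_matrix \<Omega> M" and L: "transition_matrix \<Omega> L"
    and ac: "\<And>x y. x \<in> \<Omega> \<Longrightarrow> y \<in> \<Omega> \<Longrightarrow> M x y > 0 \<Longrightarrow> L x y > 0"
    and r: "\<And>x y. x \<in> \<Omega> \<Longrightarrow> y \<in> \<Omega> \<Longrightarrow> M x y > 0 \<Longrightarrow> M x y * ln (M x y / L x y) \<le> r"
  shows "0 \<le> real_KL M L" "real_KL M L \<le> real (card \<Omega>) * r"
proof -
  let ?row = "\<lambda>x. \<Sum>y\<in>\<Omega>. M x y * ln (M x y / L x y)"
  have row: "0 \<le> ?row x" if "x \<in> \<Omega>" for x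
    using KL_row_nonneg[OF M L that] ac that by blast
  show "0 \<le> real_KL M L"
    unfolding real_KL_def by (rule sum_nonneg, rule mult_nonneg_nonneg) (simp_all add: row)
  have nonneg: "0 \<le> M x y" and row1: "(\<Sum>y\<in>\<Omega>. M x y) = 1" if "x \<in> \<Omega>" "y \<in> \<Omega>" for x y
    using M that by (auto simp: transition_matrix_def)
  have le1: "M x y \<le> 1" if "x \<in> \<Omega>" "y \<in> \<Omega>" for x y
    using member_le_sum[of y \<Omega> "M x"] nonneg row1 that by fastforce
  obtain x where x: "x \<in> \<Omega>" using \<Omega>_nonempty by blast
  have "r \<ge> 0"
  proof (rule ccontr)
    assume neg: "\<not> r \<ge> 0"
    have "M x y * ln (M x y / L x y) \<le> M x y * r" if y: "y \<in> \<Omega>" for y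
    proof (cases "M x y = 0")
      case False
      then have "M x y * ln (M x y / L x y) \<le> r" using nonneg[OF x y] by (intro r x y) auto
      also have "r \<le> M x y * r" using le1[OF x y] neg by (simp add: mult_le_cancel_right2)
      finally show ?thesis .
    qed simp
    then have "?row x \<le> (\<Sum>y\<in>\<Omega>. M x y * r)" by (intro sum_mono)
    also have "\<dots> = r" using row1[OF x x] by (simp flip: sum_distrib_right)
    finally show False using row[OF x] neg by simp
  qed
  have "?row x \<le> real (card \<Omega>) * r" if x: "x \<in> \<Omega>" for x
  proof (rule sum_bounded_above)
    fix y assume y: "y \<in> \<Omega>"
    show "M x y * ln (M x y / L x y) \<le> r"
      using r[OF x y] \<open>r \<ge> 0\<close> nonneg[OF x y] by (cases "M x y = 0") auto
  qed
  then have "real_KL M L \<le> (\<Sum>x\<in>\<Omega>. pmf \<pi> x * (real (card \<Omega>) * r))"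
    unfolding real_KL_def by (intro sum_mono mult_left_mono) auto
  then show "real_KL M L \<le> real (card \<Omega>) * r" by (simp add: sum_pmf flip: sum_distrib_right)
qed

text \<open>
  After marginalisation, the left-hand side is the divergence of \<open>keep_in T M\<close> from
  \<open>keep_in T L\<close>. The estimate \<open>ln a \<ge> 1 - 1 / a\<close> bounds it below by \<open>1 - \<Sum> marginal * keep_in T L\<close>,
  where the sum runs over the support of \<open>keep_in T M\<close> and is therefore at most \<open>1\<close>.
\<close>

lemma keep_in_gibbs:
  assumes T: "T \<subseteq> {1..d}" and M: "transition_matrix \<Omega> M" and L: "transition_matrix \<Omega> L"
    and ac: "\<And>x y. x \<in> \<Omega> \<Longrightarrow> y \<in> \<Omega> \<Longrightarrow> M x y > 0 \<Longrightarrow>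
      keep_in d X \<pi> T L (restrict x T) (restrict y T) > 0"
  shows "0 \<le> (\<Sum>x\<in>\<Omega>. \<Sum>y\<in>\<Omega>. pmf \<pi> x * M x y *
    (ln (keep_in d X \<pi> T M (restrict x T) (restrict y T))
      - ln (keep_in d X \<pi> T L (restrict x T) (restrict y T))))"
proof -
  let ?M = "keep_in d X \<pi> T M" and ?L = "keep_in d X \<pi> T L"
  have nnM: "0 \<le> M x y" and nnL: "0 \<le> L x y" if "x \<in> \<Omega>" "y \<in> \<Omega>" for x y
    using M L that by (auto simp: transition_matrix_def)
  have total: "(\<Sum>x\<in>\<Omega>. \<Sum>y\<in>\<Omega>. pmf \<pi> x * N x y) = 1" if "transition_matrix \<Omega> N" for N
    using that by (simp add: transition_matrix_def sum_pmf flip: sum_distrib_left)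
  have "(\<Sum>x\<in>\<Omega>. \<Sum>y\<in>\<Omega>. pmf \<pi> x * M x y * (?L (restrict x T) (restrict y T) / ?M (restrict x T) (restrict y T)))
    = (\<Sum>a\<in>states X T. \<Sum>b\<in>states X T. marginal T a * ?M a b * (?L a b / ?M a b))"
    by (rule sum_restrict_eq_sum_keep_in[OF T])
  also have "\<dots> \<le> (\<Sum>a\<in>states X T. \<Sum>b\<in>states X T. marginal T a * ?L a b * 1)"
  proof (intro sum_mono)
    fix a b
    show "marginal T a * ?M a b * (?L a b / ?M a b) \<le> marginal T a * ?L a b * 1"
      using marginal_nonneg[of T a] keep_in_nonneg[of L T a b] nnL by (cases "?M a b = 0") auto
  qed
  also have "\<dots> = (\<Sum>x\<in>\<Omega>. \<Sum>y\<in>\<Omega>. pmf \<pi> x * L x y * 1)"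
    by (rule sum_restrict_eq_sum_keep_in[OF T, symmetric])
  also have "\<dots> = 1" using total[OF L] by simp
  finally have le1: "(\<Sum>x\<in>\<Omega>. \<Sum>y\<in>\<Omega>. pmf \<pi> x * M x y *
      (?L (restrict x T) (restrict y T) / ?M (restrict x T) (restrict y T))) \<le> 1" .
  have "(\<Sum>x\<in>\<Omega>. \<Sum>y\<in>\<Omega>. pmf \<pi> x * M x y
      - pmf \<pi> x * M x y * (?L (restrict x T) (restrict y T) / ?M (restrict x T) (restrict y T)))
    \<le> (\<Sum>x\<in>\<Omega>. \<Sum>y\<in>\<Omega>. pmf \<pi> x * M x y *
      (ln (?M (restrict x T) (restrict y T)) - ln (?L (restrict x T) (restrict y T))))"
  proof (intro sum_mono)
    fix x y assume xy: "x \<in> \<Omega>" "y \<in> \<Omega>"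
    let ?p = "?M (restrict x T) (restrict y T)" and ?q = "?L (restrict x T) (restrict y T)"
    show "pmf \<pi> x * M x y - pmf \<pi> x * M x y * (?q / ?p) \<le> pmf \<pi> x * M x y * (ln ?p - ln ?q)"
    proof (cases "M x y = 0")
      case False
      then have "M x y > 0" using nnM[OF xy] by simp
      then have "?p > 0" "?q > 0" using ac[OF xy] keep_in_pos[of M x y T] nnM xy by auto
      then have "1 - ?q / ?p \<le> ln ?p - ln ?q"
        using ln_le_minus_one[of "?q / ?p"] by (simp add: ln_div)
      then have "pmf \<pi> x * M x y * (1 - ?q / ?p) \<le> pmf \<pi> x * M x y * (ln ?p - ln ?q)"
        using nnM[OF xy] by (intro mult_left_mono) auto
      then show ?thesis by (simp add: algebra_simps)
    qed simp
  qed
  then show ?thesis using le1 total[OF M] by (simp add: sum_subtractf)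
qed

lemma transition_matrix_mixture:
  assumes P: "\<And>i. i \<in> {1..n} \<Longrightarrow> transition_matrix \<Omega> (P i)" and u: "u \<in> prob_simplex n"
  shows "transition_matrix \<Omega> (mixture n P u)"
  unfolding transition_matrix_def
proof (intro ballI conjI)
  fix x assume x: "x \<in> \<Omega>"
  show "0 \<le> mixture n P u x y" if "y \<in> \<Omega>" for y
    using P u x that unfolding mixture_def
    by (intro sum_nonneg) (auto simp: transition_matrix_def prob_simplex_def)
  have "(\<Sum>y\<in>\<Omega>. mixture n P u x y) = (\<Sum>i=1..n. u i * (\<Sum>y\<in>\<Omega>. P i x y))"
    unfolding mixture_def sum_distrib_left by (rule sum.swap)
  also have "\<dots> = 1" using P u x by (simp add: transition_matrix_def prob_simplex_def)
  finally show "(\<Sum>y\<in>\<Omega>. mixture n P u x y) = 1" .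
qed

text \<open>
  The entropies of the \<open>P i\<close> cancel in the difference of the two sides, which leaves the expectation of
  \<open>ln (T u) - ln (T v)\<close> under the mixture with weights \<open>u\<close>, where \<open>T\<close> stands for \<open>mixture_tensor\<close>.
  The logarithm of a tensor product is a sum, and \<open>keep_in_gibbs\<close> applies to each block.
\<close>

lemma mixture_tensor_gibbs:
  assumes P: "\<And>i. i \<in> {1..n} \<Longrightarrow> transition_matrix \<Omega> (P i)"
    and un: "(\<Union>k\<in>{1..m}. S k) = {1..d}"
    and u: "u \<in> prob_simplex n" and v: "v \<in> prob_simplex n"
    and ac: "\<And>z i x y. z \<in> prob_simplex n \<Longrightarrow> i \<in> {1..n} \<Longrightarrow> x \<in> \<Omega> \<Longrightarrow> y \<in> \<Omega> \<Longrightarrow> P i x y > 0 \<Longrightarrow>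
      mixture_tensor d X \<pi> n P m S z x y \<noteq> 0"
  shows "(\<Sum>i=1..n. u i * real_KL (P i) (mixture_tensor d X \<pi> n P m S u))
    \<le> (\<Sum>i=1..n. u i * real_KL (P i) (mixture_tensor d X \<pi> n P m S v))"
proof -
  let ?T = "mixture_tensor d X \<pi> n P m S"
  let ?Q = "\<lambda>z k x y. keep_in d X \<pi> (S k) (mixture n P z) (restrict x (S k)) (restrict y (S k))"
  have nn: "0 \<le> P i x y" if "i \<in> {1..n}" "x \<in> \<Omega>" "y \<in> \<Omega>" for i x y
    using P that by (auto simp: transition_matrix_def)
  have Qpos: "?Q z k x y > 0"
    if "z \<in> prob_simplex n" "i \<in> {1..n}" "x \<in> \<Omega>" "y \<in> \<Omega>" "P i x y > 0" "k \<in> {1..m}" for z i x y k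
  proof -
    have "?Q z k x y \<noteq> 0"
      using ac[OF that(1-5)] that(6) by (auto simp: mixture_tensor_def tensor_def)
    moreover have "?Q z k x y \<ge> 0"
      using transition_matrix_mixture[OF P that(1)]
      by (intro keep_in_nonneg) (auto simp: transition_matrix_def)
    ultimately show ?thesis by simp
  qed
  have lnT: "ln (?T z x y) = (\<Sum>k=1..m. ln (?Q z k x y))" and Tpos: "?T z x y > 0"
    if "z \<in> prob_simplex n" "i \<in> {1..n}" "x \<in> \<Omega>" "y \<in> \<Omega>" "P i x y > 0" for z i x y
  proof -
    show "?T z x y > 0"
      unfolding mixture_tensor_def tensor_def by (intro prod_pos Qpos[OF that] ballI)
    have "\<forall>k\<in>{1..m}. ?Q z k x y \<noteq> 0" using Qpos[OF that] by fastforce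
    then show "ln (?T z x y) = (\<Sum>k=1..m. ln (?Q z k x y))"
      unfolding mixture_tensor_def tensor_def by (intro ln_prod) auto
  qed
  have diff: "P i x y * ln (P i x y / ?T v x y) - P i x y * ln (P i x y / ?T u x y)
      = (\<Sum>k=1..m. P i x y * (ln (?Q u k x y) - ln (?Q v k x y)))"
    if i: "i \<in> {1..n}" and xy: "x \<in> \<Omega>" "y \<in> \<Omega>" for i x y
  proof (cases "P i x y = 0")
    case False
    then have pos: "P i x y > 0" using nn[OF i xy] by simp
    have "P i x y * ln (P i x y / ?T v x y) - P i x y * ln (P i x y / ?T u x y)
      = P i x y * (ln (?T u x y) - ln (?T v x y))"
      using pos Tpos[OF u i xy pos] Tpos[OF v i xy pos] by (simp add: ln_div algebra_simps)
    then show ?thesis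
      by (simp add: lnT[OF u i xy pos] lnT[OF v i xy pos] sum_subtractf right_diff_distrib
          flip: sum_distrib_left)
  qed simp
  have "(\<Sum>i=1..n. u i * real_KL (P i) (?T v)) - (\<Sum>i=1..n. u i * real_KL (P i) (?T u))
    = (\<Sum>i=1..n. \<Sum>x\<in>\<Omega>. \<Sum>y\<in>\<Omega>. u i * (pmf \<pi> x *
        (P i x y * ln (P i x y / ?T v x y) - P i x y * ln (P i x y / ?T u x y))))"
    by (simp add: real_KL_def sum_distrib_left right_diff_distrib sum_subtractf)
  also have "\<dots> = (\<Sum>i=1..n. \<Sum>x\<in>\<Omega>. \<Sum>y\<in>\<Omega>. \<Sum>k=1..m.
      pmf \<pi> x * (u i * P i x y) * (ln (?Q u k x y) - ln (?Q v k x y)))"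
    by (intro sum.cong refl) (simp add: diff sum_distrib_left mult_ac)
  also have "\<dots> = (\<Sum>k=1..m. \<Sum>x\<in>\<Omega>. \<Sum>y\<in>\<Omega>. \<Sum>i=1..n.
      pmf \<pi> x * (u i * P i x y) * (ln (?Q u k x y) - ln (?Q v k x y)))"
    (is "(\<Sum>i=1..n. \<Sum>x\<in>\<Omega>. \<Sum>y\<in>\<Omega>. \<Sum>k=1..m. ?F i x y k) = _")
  proof -
    have "(\<Sum>i=1..n. \<Sum>x\<in>\<Omega>. \<Sum>y\<in>\<Omega>. \<Sum>k=1..m. ?F i x y k)
      = (\<Sum>x\<in>\<Omega>. \<Sum>i=1..n. \<Sum>y\<in>\<Omega>. \<Sum>k=1..m. ?F i x y k)" by (rule sum.swap)
    also have "\<dots> = (\<Sum>x\<in>\<Omega>. \<Sum>y\<in>\<Omega>. \<Sum>i=1..n. \<Sum>k=1..m. ?F i x y k)"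
      by (intro sum.cong refl sum.swap)
    also have "\<dots> = (\<Sum>x\<in>\<Omega>. \<Sum>y\<in>\<Omega>. \<Sum>k=1..m. \<Sum>i=1..n. ?F i x y k)"
      by (intro sum.cong refl sum.swap)
    also have "\<dots> = (\<Sum>x\<in>\<Omega>. \<Sum>k=1..m. \<Sum>y\<in>\<Omega>. \<Sum>i=1..n. ?F i x y k)"
      by (intro sum.cong refl sum.swap)
    also have "\<dots> = (\<Sum>k=1..m. \<Sum>x\<in>\<Omega>. \<Sum>y\<in>\<Omega>. \<Sum>i=1..n. ?F i x y k)"
      by (rule sum.swap)
    finally show ?thesis .
  qed
  also have "\<dots> = (\<Sum>k=1..m. \<Sum>x\<in>\<Omega>. \<Sum>y\<in>\<Omega>.
      pmf \<pi> x * mixture n P u x y * (ln (?Q u k x y) - ln (?Q v k x y)))"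
    by (simp add: mixture_def sum_distrib_left sum_distrib_right)
  also have "\<dots> \<ge> 0"
  proof (rule sum_nonneg, rule keep_in_gibbs)
    show "transition_matrix \<Omega> (mixture n P u)" using P u by (rule transition_matrix_mixture)
    show "transition_matrix \<Omega> (mixture n P v)" using P v by (rule transition_matrix_mixture)
    fix k assume k: "k \<in> {1..m}"
    show "S k \<subseteq> {1..d}" using un k by blast
    fix x y assume xy: "x \<in> \<Omega>" "y \<in> \<Omega>" and pos: "mixture n P u x y > 0"
    then have "(\<Sum>i=1..n. u i * P i x y) \<noteq> 0" by (simp add: mixture_def)
    then obtain i where i: "i \<in> {1..n}" "u i * P i x y \<noteq> 0"
      by (rule sum.not_neutral_contains_not_neutral)
    then have "P i x y > 0" using nn[OF i(1) xy] by auto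
    then show "?Q v k x y > 0" using Qpos v i(1) xy k by blast
  qed
  finally show ?thesis by simp
qed

end

section \<open>Convergence of the projected subgradient algorithm\<close>

text \<open>This stepsize makes the two terms of the bound equal.\<close>

lemma optimal_stepsize_bound:
  fixes N B t \<eta> :: real
  assumes "\<eta> = sqrt (N / (B * t))" "\<eta> > 0" "t > 0" "N \<ge> 0" "B \<ge> 0"
  shows "N / (2 * \<eta> * t) + \<eta> * B / 2 = sqrt (N * B / t)"
proof -
  have pos: "B > 0" "N > 0" using assms by (auto simp: less_le)
  have sq: "\<eta>\<^sup>2 = N / (B * t)" using assms by simp
  have "N / (2 * \<eta> * t) = \<eta> * B / 2"
    using sq assms pos by (simp add: field_simps power2_eq_square)
  moreover have "\<eta> * B = sqrt (N * B / t)"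
  proof (rule real_sqrt_unique[symmetric])
    show "(\<eta> * B)\<^sup>2 = N * B / t"
      using sq pos assms(3) by (simp add: power_mult_distrib field_simps power2_eq_square)
  qed (use assms in simp)
  ultimately show ?thesis by simp
qed

theorem theorem5p2:
  fixes d n m t :: nat
    and X :: "nat \<Rightarrow> 'a set"
    and \<pi> :: "(nat \<Rightarrow> 'a) pmf"
    and P :: "nat \<Rightarrow> (nat \<Rightarrow> 'a) \<Rightarrow> (nat \<Rightarrow> 'a) \<Rightarrow> real"
    and S :: "nat \<Rightarrow> nat set"
    and \<eta> :: real
    and w :: "nat \<Rightarrow> nat \<Rightarrow> real"
    and wbar wstar :: "nat \<Rightarrow> real"
  assumes "\<forall>i\<in>{1..d}. finite (X i)"
    and "set_pmf \<pi> = states X {1..d}"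
    and "\<forall>i\<in>{1..n}. transition_matrix (states X {1..d}) (P i)"
    and "\<forall>i\<in>{1..n}. stationary (states X {1..d}) \<pi> (P i)"
    and "disjoint_family_on S {1..m}"
    and "(\<Union>k\<in>{1..m}. S k) = {1..d}"
    and "\<eta> > 0"
    and "t \<ge> 1"
    and "proj_subgrad_run d X \<pi> n P m S \<eta> t w"
    and "wbar = (\<lambda>j. (1 / real t) * (\<Sum>i=1..t. w i j))"
    and "is_arg_min (objective d X \<pi> n P m S) (\<lambda>u. u \<in> prob_simplex n) wstar"
  shows "objective d X \<pi> n P m S wbar - objective d X \<pi> n P m S wstar
           \<le> ereal (real n / (2 * \<eta> * real t)) + ereal \<eta> * step_const d X \<pi> n P m S / 2
       \<and> (\<forall>B. step_const d X \<pi> n P m S = ereal B \<and> \<eta> = sqrt (real n / (B * real t)) \<longrightarrow>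
            objective d X \<pi> n P m S wbar - objective d X \<pi> n P m S wstar
              \<le> ereal (sqrt (real n * B / real t))
          \<and> (\<forall>\<epsilon>>0. int t = \<lceil>real n * B / \<epsilon>\<^sup>2\<rceil> \<longrightarrow>
               objective d X \<pi> n P m S wbar - objective d X \<pi> n P m S wstar \<le> ereal \<epsilon>))"
proof -
  interpret positive_product_pmf d X \<pi>
    using assms(1,2) by unfold_locales auto
  note P = bspec[OF assms(3)]
  let ?T = "mixture_tensor d X \<pi> n P m S"
  let ?h = "objective d X \<pi> n P m S"
  let ?B = "step_const d X \<pi> n P m S"
  let ?I = "{(v, i, x, y). v \<in> prob_simplex n \<and> i \<in> {1..n} \<and> x \<in> \<Omega> \<and> y \<in> \<Omega> \<and> P i x y > 0}"
  define r where "r = (SUP (v, i, x, y) \<in> ?I. xlogx_div (P i x y) (?T v x y))"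
  have B: "?B = ereal (real n) * (ereal (real (card \<Omega>)) * r)\<^sup>2"
    by (simp add: step_const_def r_def)
  have r_upper: "xlogx_div (P i x y) (?T v x y) \<le> r"
    if "v \<in> prob_simplex n" "i \<in> {1..n}" "x \<in> \<Omega>" "y \<in> \<Omega>" "P i x y > 0" for v i x y
    unfolding r_def using that by (intro SUP_upper2[of "(v, i, x, y)"]) auto
  have wstar: "wstar \<in> prob_simplex n" using assms(11) by (simp add: is_arg_min_def)
  have n: "n \<ge> 1"
  proof (rule ccontr)
    assume "\<not> n \<ge> 1"
    then show False using wstar by (simp add: prob_simplex_def)
  qed
  \<comment> \<open>The supremum is over a nonempty set, because each row of \<open>P 1\<close> has a positive entry.\<close>
  have "r \<noteq> - \<infinity>"
  proof -
    obtain x where x: "x \<in> \<Omega>" using \<Omega>_nonempty by blast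
    have P1: "(\<Sum>y\<in>\<Omega>. P 1 x y) = 1" "\<And>y. y \<in> \<Omega> \<Longrightarrow> 0 \<le> P 1 x y"
      using P[of 1] n x by (auto simp: transition_matrix_def)
    then obtain y where y: "y \<in> \<Omega>" "P 1 x y \<noteq> 0" by (metis sum.neutral zero_neq_one)
    then have "xlogx_div (P 1 x y) (?T wstar x y) \<le> r"
      using P1(2)[OF y(1)] n x by (intro r_upper wstar) auto
    moreover have "xlogx_div p q \<noteq> - \<infinity>" for p q by (simp add: xlogx_div_def)
    ultimately show ?thesis by auto
  qed
  then consider (infinite) "r = \<infinity>" | (finite) c where "r = ereal c" by (cases r) auto
  then show ?thesis
  proof cases
    case infinite
    then have "?B = \<infinity>" using n \<Omega>_nonempty by (simp add: B power2_eq_square)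
    then show ?thesis using \<open>\<eta> > 0\<close> by simp
  next
    case (finite c)
    define C where "C = real (card \<Omega>) * c"
    have BC: "?B = ereal (real n * C\<^sup>2)" by (simp add: B finite C_def)
    have ac: "?T v x y \<noteq> 0" and term_le: "P i x y * ln (P i x y / ?T v x y) \<le> c"
      if "v \<in> prob_simplex n" "i \<in> {1..n}" "x \<in> \<Omega>" "y \<in> \<Omega>" "P i x y > 0" for v i x y
      using r_upper[OF that] that(5) by (auto simp: xlogx_div_def finite split: if_splits)
    define D where "D v i = real_KL (P i) (?T v)" for v i
    have T: "transition_matrix \<Omega> (?T v)" if "v \<in> prob_simplex n" for v
      unfolding mixture_tensor_def
      using transition_matrix_tensor_keep_in[OF transition_matrix_mixture[OF P that] assms(5,6)]
      by simp
    have nn: "0 \<le> P i x y" "0 \<le> ?T v x y"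
      if "i \<in> {1..n}" "x \<in> \<Omega>" "y \<in> \<Omega>" "v \<in> prob_simplex n" for i x y v
      using P T that by (auto simp: transition_matrix_def)
    have KL: "KL_div \<Omega> \<pi> (P i) (?T v) = ereal (D v i)"
      if "v \<in> prob_simplex n" "i \<in> {1..n}" for v i
      unfolding D_def using ac[OF that] nn(1)[OF that(2)] that(1)
      by (intro KL_div_eq_real_KL) (simp add: less_le)
    have D: "0 \<le> D v i \<and> D v i \<le> C" if "v \<in> prob_simplex n" "i \<in> {1..n}" for v i
    proof -
      have "?T v x y > 0" if "x \<in> \<Omega>" "y \<in> \<Omega>" "P i x y > 0" for x y
        using ac[OF \<open>v \<in> _\<close> \<open>i \<in> _\<close> that] nn(2)[OF \<open>i \<in> _\<close> that(1,2) \<open>v \<in> _\<close>] by simp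
      then show ?thesis
        unfolding D_def C_def
        using real_KL_bounds[OF P[OF that(2)] T[OF that(1)] _ term_le[OF that]] by blast
    qed
    have gibbs: "(\<Sum>i=1..n. u i * D u i) \<le> (\<Sum>i=1..n. u i * D v i)"
      if "u \<in> prob_simplex n" "v \<in> prob_simplex n" for u v
      unfolding D_def by (rule mixture_tensor_gibbs[OF P assms(6) that ac])
    have obj: "?h v = ereal (- (\<Sum>i=1..n. v i * D v i))" if "v \<in> prob_simplex n" for v
      using KL[OF that] by (simp add: objective_def)
    have w: "w i \<in> prob_simplex n" if "i \<in> {1..t}" for i
      using assms(9) that by (auto simp: proj_subgrad_run_def is_arg_min_def)
    have step: "is_arg_min (\<lambda>u. (L2_set (\<lambda>j. u j - (w i j - \<eta> * (D (w i) n - D (w i) j))) {1..n})\<^sup>2)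
        (\<lambda>u. u \<in> prob_simplex n) (w (Suc i))" if i: "i \<in> {1..<t}" for i
    proof -
      have wi: "w i \<in> prob_simplex n" using i by (intro w) auto
      have Suc_i: "Suc i \<in> {1..t}" using i by simp
      obtain v where v: "\<forall>j\<in>{1..n}.
            ereal (v j) = ereal (w i j) - ereal \<eta> * subgrad d X \<pi> n P m S (w i) j"
        and arg: "is_arg_min (\<lambda>u. (L2_set (\<lambda>j. u j - v j) {1..n})\<^sup>2)
            (\<lambda>u. u \<in> prob_simplex n) (w (Suc i))"
        using assms(9)[unfolded proj_subgrad_run_def, THEN conjunct2, THEN bspec, OF Suc_i]
        unfolding diff_Suc_1 by blast
      have "v j = w i j - \<eta> * (D (w i) n - D (w i) j)" if "j \<in> {1..n}" for j
        using bspec[OF v that] KL[OF wi that] KL[OF wi, of n] n by (simp add: subgrad_def)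
      then have "L2_set (\<lambda>j. u j - v j) {1..n}
          = L2_set (\<lambda>j. u j - (w i j - \<eta> * (D (w i) n - D (w i) j))) {1..n}" for u
        by (intro L2_set_cong) auto
      then show ?thesis using arg by simp
    qed
    have wbar: "wbar \<in> prob_simplex n"
      unfolding assms(10) by (rule average_in_prob_simplex[OF assms(8) w])
    have "(\<Sum>i=1..n. wstar i * D wstar i) - (\<Sum>i=1..n. wbar i * D wbar i)
        \<le> real n / (2 * \<eta> * real t) + \<eta> * (real n * C\<^sup>2) / 2"
      by (rule projected_subgradient_gap[OF gibbs D step w wstar assms(7,8,10)])
    then have gap: "?h wbar - ?h wstar \<le> ereal (real n / (2 * \<eta> * real t) + \<eta> * (real n * C\<^sup>2) / 2)"
      by (simp add: obj[OF wbar] obj[OF wstar])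
    have fixed: "ereal (real n / (2 * \<eta> * real t)) + ereal \<eta> * ?B / 2
        = ereal (real n / (2 * \<eta> * real t) + \<eta> * (real n * C\<^sup>2) / 2)"
      by (simp add: BC)
    have tuned: "?h wbar - ?h wstar \<le> ereal (sqrt (real n * B / real t))"
      if "?B = ereal B" "\<eta> = sqrt (real n / (B * real t))" for B
    proof -
      have Beq: "B = real n * C\<^sup>2" using that(1) BC by simp
      then have "B \<ge> 0" by simp
      then have "real n / (2 * \<eta> * real t) + \<eta> * B / 2 = sqrt (real n * B / real t)"
        using assms(7,8) by (intro optimal_stepsize_bound that(2)) auto
      then show ?thesis using gap unfolding Beq by simp
    qed
    have accurate: "?h wbar - ?h wstar \<le> ereal \<epsilon>"
      if that': "?B = ereal B" "\<eta> = sqrt (real n / (B * real t))"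
        and \<epsilon>: "\<epsilon> > 0" "int t = \<lceil>real n * B / \<epsilon>\<^sup>2\<rceil>" for B \<epsilon>
    proof -
      have "real n * B / \<epsilon>\<^sup>2 \<le> real t" using \<epsilon>(2) by linarith
      then have "real n * B / real t \<le> \<epsilon>\<^sup>2" using \<epsilon>(1) assms(8) by (simp add: field_simps)
      then have "sqrt (real n * B / real t) \<le> \<epsilon>" using \<epsilon>(1) by (simp add: real_le_lsqrt)
      then show ?thesis using tuned[OF that'] by (meson ereal_less_eq(3) order_trans)
    qed
    show ?thesis using gap tuned accurate unfolding fixed by blast
  qed
qed

end
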